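(* Let $L_{eq}=\{a^nb^n\mid n\ge 0\}\subseteq\{a,b\}^*$. There exists a natural number $k$ such that for every $\epsilon>0$ there exists a $k$-state one-way probabilistic finite automaton with restart $\mathcal{P}_\epsilon$ recognizing $L_{eq}$ with error bound $\epsilon$ and with expected runtime $O\big((\frac{2}{\epsilon^2})^{|w|}|w|\big)$, where $w$ is the input string.
   Context: Let $\vdash,\dashv$ be end-markers, $\Sigma=\{a,b\}$, $\Gamma=\Sigma\cup\{\vdash,\dashv\}$. A one-way probabilistic finite automaton with restart has a finite state set $Q$ partitioned into disjoint sets $Q_{non}$ (nonhalting), $Q_{acc}$, $Q_{rej}$, $Q_{restart}$, an initial state $q_0\in Q_{non}$, and for each $\sigma\in\Gamma$ a stochastic matrix giving transition probabilities between states when reading $\sigma$. On input $w$, each round starts in $q_0$ with the head on $\vdash$ and reads $\vdash w\dashv$ left to right, one symbol per step, moving to a random next state; entering an accepting/rejecting state halts with that answer; entering a restarting state ends the round and begins a new round in $q_0$ on $\vdash$; each round ends by halting or restarting with probability 1. Acceptance/rejection probabilities are those of eventually accepting/rejecting; runtime counts all steps of all rounds. The automaton recognizes $L$ with error bound $\epsilon$ if members are accepted with probability at least $1-\epsilon$ and nonmembers rejected with probability at least $1-\epsilon$.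
   Formalization: The error bound is restricted to 0 < ε ≤ 1: for ε > √2 the claim is false, since the runtime bound tends to 0 while every run takes at least one step, and for any ε > 1 the error condition is vacuous. *)

theory Defs
  imports "HOL-Probability.Probability" "HOL-Library.Landau_Symbols"
begin

datatype letter = La | Lb

datatype tape_symbol = LeftEnd | Letter letter | RightEnd

definition tape :: "letter list \<Rightarrow> tape_symbol list" where
  "tape w = LeftEnd # map Letter w @ [RightEnd]"

text \<open>
  A row of a stochastic matrix is a probability distribution on states, so the matrix for the
  symbol \<open>\<sigma>\<close> is given by its rows \<open>trans P \<sigma> q\<close>.
\<close>

record 'q restart_pfa =
  nonhalting :: "'q set"
  accepting :: "'q set"
  rejecting :: "'q set"
  restarting :: "'q set"
  initial :: 'q
  trans :: "tape_symbol \<Rightarrow> 'q \<Rightarrow> 'q pmf"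

definition states :: "'q restart_pfa \<Rightarrow> 'q set" where
  "states P = nonhalting P \<union> accepting P \<union> rejecting P \<union> restarting P"

definition round_result :: "'q restart_pfa \<Rightarrow> letter list \<Rightarrow> 'q pmf" where
  "round_result P w =
     foldl (\<lambda>D \<sigma>. bind_pmf D (\<lambda>q. if q \<in> nonhalting P then trans P \<sigma> q else return_pmf q))
       (return_pmf (initial P)) (tape w)"

definition is_restart_pfa :: "'q restart_pfa \<Rightarrow> bool" where
  "is_restart_pfa P \<longleftrightarrow>
     finite (states P) \<and>
     nonhalting P \<inter> accepting P = {} \<and> nonhalting P \<inter> rejecting P = {} \<and>
     nonhalting P \<inter> restarting P = {} \<and> accepting P \<inter> rejecting P = {} \<and>
     accepting P \<inter> restarting P = {} \<and> rejecting P \<inter> restarting P = {} \<and>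
     initial P \<in> nonhalting P \<and>
     (\<forall>\<sigma>. \<forall>q\<in>states P. set_pmf (trans P \<sigma> q) \<subseteq> states P) \<and>
     (\<forall>w. AE q in measure_pmf (round_result P w). q \<notin> nonhalting P)"

text \<open>
  A configuration is a state together with the head position on the tape.  Entering a restarting
  state immediately leads to the initial configuration, at no extra cost in steps.
  Configurations with an accepting or rejecting state are absorbing.  By the last clause of
  \<open>is_restart_pfa\<close>, the head never leaves the tape in a nonhalting state.
\<close>

definition step :: "'q restart_pfa \<Rightarrow> letter list \<Rightarrow> 'q \<times> nat \<Rightarrow> ('q \<times> nat) pmf" where
  "step P w c =
     (case c of (q, i) \<Rightarrow>
        if q \<in> nonhalting P \<and> i < length (tape w)
        then map_pmf (\<lambda>q'. if q' \<in> restarting P then (initial P, 0) else (q', Suc i))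
               (trans P (tape w ! i) q)
        else return_pmf c)"

primrec run :: "'q restart_pfa \<Rightarrow> letter list \<Rightarrow> nat \<Rightarrow> ('q \<times> nat) pmf" where
  "run P w 0 = return_pmf (initial P, 0)"
| "run P w (Suc n) = bind_pmf (run P w n) (step P w)"

definition accepted_by :: "'q restart_pfa \<Rightarrow> letter list \<Rightarrow> nat \<Rightarrow> real" where
  "accepted_by P w n = measure_pmf.prob (run P w n) {c. fst c \<in> accepting P}"

definition rejected_by :: "'q restart_pfa \<Rightarrow> letter list \<Rightarrow> nat \<Rightarrow> real" where
  "rejected_by P w n = measure_pmf.prob (run P w n) {c. fst c \<in> rejecting P}"

text \<open>
  Halting configurations are absorbing, so the events of having accepted (rejected) within \<open>n\<close>
  steps increase with \<open>n\<close>, and the probability of their union is the supremum.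
\<close>

definition accept_prob :: "'q restart_pfa \<Rightarrow> letter list \<Rightarrow> real" where
  "accept_prob P w = (SUP n. accepted_by P w n)"

definition reject_prob :: "'q restart_pfa \<Rightarrow> letter list \<Rightarrow> real" where
  "reject_prob P w = (SUP n. rejected_by P w n)"

definition recognizes_with_error ::
    "'q restart_pfa \<Rightarrow> letter list set \<Rightarrow> real \<Rightarrow> bool" where
  "recognizes_with_error P L \<epsilon> \<longleftrightarrow>
     (\<forall>w\<in>L. accept_prob P w \<ge> 1 - \<epsilon>) \<and> (\<forall>w. w \<notin> L \<longrightarrow> reject_prob P w \<ge> 1 - \<epsilon>)"

definition halts_at :: "'q restart_pfa \<Rightarrow> letter list \<Rightarrow> nat \<Rightarrow> real" where
  "halts_at P w n =
     (if n = 0 then accepted_by P w 0 + rejected_by P w 0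
      else (accepted_by P w n + rejected_by P w n)
           - (accepted_by P w (n - 1) + rejected_by P w (n - 1)))"

text \<open>
  The expectation of the number of steps until halting, a random variable that is infinite on the
  event of never halting.  Note that \<open>\<infinity> * 0 = 0\<close> in \<^typ>\<open>ennreal\<close>.
\<close>

definition expected_runtime :: "'q restart_pfa \<Rightarrow> letter list \<Rightarrow> ennreal" where
  "expected_runtime P w =
     (\<Sum>n. of_nat n * ennreal (halts_at P w n))
     + \<infinity> * ennreal (1 - (accept_prob P w + reject_prob P w))"

text \<open>
  The constant in \<open>O\<close> may depend on the automaton, and the asymptotics is in the input length.
  The finiteness condition is needed since \<^const>\<open>enn2real\<close> maps \<open>\<infinity>\<close> to \<open>0\<close>.
\<close>

definition has_expected_runtime_O ::
    "'q restart_pfa \<Rightarrow> (letter list \<Rightarrow> real) \<Rightarrow> bool" where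
  "has_expected_runtime_O P g \<longleftrightarrow>
     (\<forall>w. expected_runtime P w < \<infinity>) \<and>
     (\<lambda>w. enn2real (expected_runtime P w)) \<in> O[filtercomap length at_top](g)"

definition L_eq :: "letter list set" where
  "L_eq = {replicate n La @ replicate n Lb | n. True}"

end

theory Submission imports Defs
begin

text \<open>
  If a round accepts with probability \<open>\<alpha>\<close> and rejects with probability \<open>\<beta>\<close>, then restarting gives
  overall probabilities \<open>\<alpha> / (\<alpha> + \<beta>)\<close> and \<open>\<beta> / (\<alpha> + \<beta>)\<close>, and at most \<open>1 / (\<alpha> + \<beta>)\<close> expected rounds.

  With \<open>x = \<epsilon>\<^sup>2 / 2\<close>, the automaton makes a round on \<open>a\<^sup>m b\<^sup>n\<close> accept with probability proportional
  to \<open>x\<^bsup>m+n\<^esup>\<close> and reject with probability proportional to \<open>\<epsilon> / 2 * (x\<^bsup>2m\<^esup> + x\<^bsup>2n\<^esup>)\<close>. For \<open>m = n\<close> the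
  ratio of the two is \<open>1 : \<epsilon>\<close>. For \<open>m \<noteq> n\<close> we have \<open>x\<^bsup>m+n\<^esup> \<le> x (x\<^bsup>2m\<^esup> + x\<^bsup>2n\<^esup>)\<close>, so the ratio is at
  most \<open>\<epsilon> : 1\<close>. Words of any other form are never accepted. On every word \<open>w\<close> the accepting track
  alone makes a round halt with probability at least \<open>x\<^bsup>|w|\<^esup> / (1 + \<epsilon>)\<close>, hence the running time.
\<close>

subsection \<open>Rounds and restarts\<close>

text \<open>\<open>round_result\<close> folds distributions from the left; recursion from the front
  of the tape lets a round be resumed in any state with any remaining tape.\<close>

primrec round_from :: "'q restart_pfa \<Rightarrow> tape_symbol list \<Rightarrow> 'q \<Rightarrow> 'q pmf" where
  "round_from P [] q = return_pmf q"
| "round_from P (\<sigma> # \<sigma>s) q =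
     (if q \<in> nonhalting P then bind_pmf (trans P \<sigma> q) (round_from P \<sigma>s) else return_pmf q)"

lemma round_from_halted: "q \<notin> nonhalting P \<Longrightarrow> round_from P \<sigma>s q = return_pmf q"
  by (cases \<sigma>s) auto

text \<open>The initial distribution \<open>D\<close> is arbitrary because the fold updates it in
  every step; associativity of \<open>bind_pmf\<close> then carries the induction, halted states
  being fixed.\<close>

lemma foldl_round_from:
  "foldl (\<lambda>D \<sigma>. bind_pmf D (\<lambda>q. if q \<in> nonhalting P then trans P \<sigma> q else return_pmf q)) D \<sigma>s
     = bind_pmf D (round_from P \<sigma>s)"
proof (induction \<sigma>s arbitrary: D)
  case Nil
  show ?case by (simp add: bind_return_pmf')
next
  case (Cons \<sigma> \<sigma>s)
  have "bind_pmf (if q \<in> nonhalting P then trans P \<sigma> q else return_pmf q) (round_from P \<sigma>s)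
      = round_from P (\<sigma> # \<sigma>s) q" for q
    by (simp add: round_from_halted bind_return_pmf)
  then show ?case by (simp add: Cons bind_assoc_pmf)
qed

lemma round_result_eq: "round_result P w = round_from P (tape w) (initial P)"
  unfolding round_result_def foldl_round_from by (simp add: bind_return_pmf)

section \<open>Expectations over finitely supported distributions\<close>

lemma prob_bind_pmf:
  "measure_pmf.prob (bind_pmf M f) S = (\<integral>x. measure_pmf.prob (f x) S \<partial>measure_pmf M)"
proof -
  have "ennreal (measure_pmf.prob (bind_pmf M f) S)
      = (\<integral>\<^sup>+x. ennreal (measure_pmf.prob (f x) S) \<partial>measure_pmf M)"
    unfolding measure_pmf.emeasure_eq_measure[symmetric] by (rule emeasure_bind_pmf)
  also have "\<dots> = ennreal (\<integral>x. measure_pmf.prob (f x) S \<partial>measure_pmf M)"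
    by (intro nn_integral_eq_integral measure_pmf.integrable_const_bound[where B = 1]) auto
  finally show ?thesis by (simp add: integral_nonneg_AE)
qed

lemma expectation_finite_mono:
  fixes f g :: "'a \<Rightarrow> real"
  assumes "finite (set_pmf M)" "\<And>x. x \<in> set_pmf M \<Longrightarrow> f x \<le> g x"
  shows "measure_pmf.expectation M f \<le> measure_pmf.expectation M g"
  using assms by (intro integral_mono_AE integrable_measure_pmf_finite AE_pmfI) auto

text \<open>Finite supports reduce the exchange of integrals to a swap of finite sums. The
  potentials below are averaged along the run in this way.\<close>

lemma expectation_bind_finite:
  fixes g :: "'b \<Rightarrow> real"
  assumes "finite (set_pmf M)" "\<And>x. x \<in> set_pmf M \<Longrightarrow> finite (set_pmf (f x))"
  shows "measure_pmf.expectation (bind_pmf M f) g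
    = measure_pmf.expectation M (\<lambda>x. measure_pmf.expectation (f x) g)"
proof -
  have fin: "finite (set_pmf (bind_pmf M f))" using assms by auto
  have "measure_pmf.expectation (bind_pmf M f) g
      = (\<Sum>y\<in>set_pmf (bind_pmf M f). pmf (bind_pmf M f) y * g y)"
    by (subst integral_measure_pmf_real[OF fin]) (auto simp: mult.commute)
  also have "\<dots> = (\<Sum>y\<in>set_pmf (bind_pmf M f). (\<Sum>x\<in>set_pmf M. pmf M x * pmf (f x) y) * g y)"
    by (intro sum.cong refl arg_cong2[where f = times], subst pmf_bind,
        subst integral_measure_pmf_real[OF assms(1)]) (auto simp: mult.commute)
  also have "\<dots> = (\<Sum>x\<in>set_pmf M. \<Sum>y\<in>set_pmf (bind_pmf M f). pmf M x * pmf (f x) y * g y)"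
    unfolding sum_distrib_right by (rule sum.swap)
  also have "\<dots> = (\<Sum>x\<in>set_pmf M. pmf M x * measure_pmf.expectation (f x) g)"
  proof (rule sum.cong[OF refl])
    fix x assume x: "x \<in> set_pmf M"
    have "measure_pmf.expectation (f x) g = (\<Sum>y\<in>set_pmf (bind_pmf M f). g y * pmf (f x) y)"
      using x by (intro integral_measure_pmf_real[OF fin]) auto
    then show "(\<Sum>y\<in>set_pmf (bind_pmf M f). pmf M x * pmf (f x) y * g y)
        = pmf M x * measure_pmf.expectation (f x) g"
      by (simp add: sum_distrib_left mult_ac)
  qed
  also have "\<dots> = measure_pmf.expectation M (\<lambda>x. measure_pmf.expectation (f x) g)"
    by (subst integral_measure_pmf_real[OF assms(1)]) (auto simp: mult.commute)
  finally show ?thesis .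
qed

text \<open>
  Restricting to these configurations rules out those stuck behind the right end-marker in a
  nonhalting state, which \<^const>\<open>step\<close> would leave unchanged forever.
\<close>

definition live :: "'q restart_pfa \<Rightarrow> letter list \<Rightarrow> ('q \<times> nat) set" where
  "live P w = {(q, i). q \<in> states P \<and> q \<notin> restarting P \<and>
     set_pmf (round_from P (drop i (tape w)) q) \<inter> nonhalting P = {}}"

section \<open>Live configurations and the run of an automaton\<close>

locale restart_pfa =
  fixes P :: "'q restart_pfa" and w :: "letter list"
  assumes pfa: "is_restart_pfa P"
begin

definition acc_round :: real where
  "acc_round = measure_pmf.prob (round_result P w) (accepting P)"

definition rej_round :: real where
  "rej_round = measure_pmf.prob (round_result P w) (rejecting P)"

abbreviation start :: "'q \<times> nat" where "start \<equiv> (initial P, 0)"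

lemma disj:
  "q \<in> nonhalting P \<Longrightarrow> q \<notin> accepting P \<and> q \<notin> rejecting P \<and> q \<notin> restarting P"
  "q \<in> accepting P \<Longrightarrow> q \<notin> rejecting P \<and> q \<notin> restarting P \<and> q \<notin> nonhalting P"
  "q \<in> rejecting P \<Longrightarrow> q \<notin> restarting P \<and> q \<notin> nonhalting P \<and> q \<notin> accepting P"
  "q \<in> restarting P \<Longrightarrow> q \<notin> nonhalting P \<and> q \<notin> accepting P \<and> q \<notin> rejecting P"
  using pfa unfolding is_restart_pfa_def by blast+

lemma disjoint:
  "accepting P \<inter> rejecting P = {}" "accepting P \<inter> restarting P = {}"
  "rejecting P \<inter> restarting P = {}"
  using pfa unfolding is_restart_pfa_def by blast+

lemma initial_nonhalting: "initial P \<in> nonhalting P"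
  using pfa unfolding is_restart_pfa_def by blast

lemma trans_states: "q \<in> states P \<Longrightarrow> q' \<in> set_pmf (trans P \<sigma> q) \<Longrightarrow> q' \<in> states P"
  using pfa unfolding is_restart_pfa_def by blast

lemma finite_trans: "q \<in> states P \<Longrightarrow> finite (set_pmf (trans P \<sigma> q))"
  using pfa unfolding is_restart_pfa_def by (meson finite_subset)

lemma round_from_states:
  "q \<in> states P \<Longrightarrow> q' \<in> set_pmf (round_from P \<sigma>s q) \<Longrightarrow> q' \<in> states P"
  by (induction \<sigma>s arbitrary: q) (auto split: if_splits dest: trans_states)

lemma start_live: "start \<in> live P w"
  using pfa initial_nonhalting disj(1)[OF initial_nonhalting]
  by (auto simp: live_def states_def is_restart_pfa_def AE_measure_pmf_iff round_result_eq)

text \<open>Behind the tape \<open>drop\<close> is empty, so \<open>round_from\<close> would return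
  the nonhalting \<open>q\<close> itself.\<close>

lemma live_lt_length:
  assumes "(q, i) \<in> live P w" "q \<in> nonhalting P"
  shows "i < length (tape w)"
  using assms by (rule_tac ccontr) (auto simp: live_def)

lemma live_step:
  assumes c: "c \<in> live P w" and c': "c' \<in> set_pmf (step P w c)"
  shows "c' \<in> live P w"
proof -
  obtain q i where qi: "c = (q, i)" by fastforce
  show ?thesis
  proof (cases "q \<in> nonhalting P")
    case False
    then show ?thesis using assms by (auto simp: step_def qi)
  next
    case True
    have i: "i < length (tape w)" using live_lt_length c True qi by blast
    obtain q' where q': "q' \<in> set_pmf (trans P (tape w ! i) q)"
      "c' = (if q' \<in> restarting P then start else (q', Suc i))"
      using c' True i by (auto simp: step_def qi)
    show ?thesis
    proof (cases "q' \<in> restarting P")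
      case True
      then show ?thesis using q' start_live by simp
    next
      case nr: False
      \<comment> \<open>Every end of the round reachable from \<open>q'\<close> is also reachable
        from \<open>q\<close>, so none of them is nonhalting.\<close>
      have "set_pmf (round_from P (drop (Suc i) (tape w)) q')
          \<subseteq> set_pmf (round_from P (drop i (tape w)) q)"
        using q'(1) True by (auto simp: Cons_nth_drop_Suc[OF i, symmetric])
      moreover have "q' \<in> states P" using c q'(1) trans_states by (auto simp: live_def qi)
      ultimately show ?thesis using q' nr c by (auto simp: live_def qi)
    qed
  qed
qed

lemma finite_step: "c \<in> live P w \<Longrightarrow> finite (set_pmf (step P w c))"
  by (auto simp: step_def live_def finite_trans split: prod.splits)

lemma run_live: "c \<in> set_pmf (run P w n) \<Longrightarrow> c \<in> live P w"
  by (induction n arbitrary: c) (auto simp: start_live dest: live_step)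

lemma finite_run: "finite (set_pmf (run P w n))"
  by (induction n) (auto simp: finite_step dest: run_live)

lemma expectation_run_Suc:
  fixes g :: "'q \<times> nat \<Rightarrow> real"
  shows "measure_pmf.expectation (run P w (Suc n)) g
    = measure_pmf.expectation (run P w n) (\<lambda>c. measure_pmf.expectation (step P w c) g)"
  by (simp add: expectation_bind_finite finite_run finite_step run_live)

lemma expectation_step:
  fixes g :: "'q \<times> nat \<Rightarrow> real"
  assumes "(q, i) \<in> live P w" "q \<in> nonhalting P"
  shows "measure_pmf.expectation (step P w (q, i)) g
    = measure_pmf.expectation (trans P (tape w ! i) q)
        (\<lambda>q'. g (if q' \<in> restarting P then start else (q', Suc i)))"
  using live_lt_length[OF assms] assms by (simp add: step_def)

section \<open>Outcome of the current round as a function of the configuration\<close>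

definition ends_in :: "'q set \<Rightarrow> 'q \<times> nat \<Rightarrow> real" where
  "ends_in S c = measure_pmf.prob (round_from P (drop (snd c) (tape w)) (fst c)) S"

lemma ends_in_halted: "q \<notin> nonhalting P \<Longrightarrow> ends_in S (q, i) = indicator S q"
  by (simp add: ends_in_def round_from_halted)

text \<open>Here a restart is an outcome of the round, so the successor is always
  \<open>(q', Suc i)\<close>; \<open>step\<close> differs only in sending restarts to
  \<open>start\<close>.\<close>

lemma ends_in_step:
  assumes "(q, i) \<in> live P w" "q \<in> nonhalting P"
  shows "ends_in S (q, i)
    = measure_pmf.expectation (trans P (tape w ! i) q) (\<lambda>q'. ends_in S (q', Suc i))"
  using assms
  by (simp add: ends_in_def Cons_nth_drop_Suc[OF live_lt_length[OF assms], symmetric]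
      prob_bind_pmf)

lemma ends_in_start:
  "ends_in (accepting P) start = acc_round" "ends_in (rejecting P) start = rej_round"
  by (simp_all add: ends_in_def acc_round_def rej_round_def round_result_eq)

text \<open>A round almost surely ends in exactly one of the three disjoint halting or restarting
  classes.\<close>

lemma ends_in_restarting: "ends_in (restarting P) start = 1 - (acc_round + rej_round)"
proof -
  let ?D = "round_result P w"
  have "set_pmf ?D \<subseteq> states P"
    using round_from_states initial_nonhalting by (auto simp: round_result_eq states_def)
  moreover have "set_pmf ?D \<inter> nonhalting P = {}"
    using pfa by (auto simp: is_restart_pfa_def AE_measure_pmf_iff)
  ultimately have "set_pmf ?D \<subseteq> accepting P \<union> rejecting P \<union> restarting P"
    by (auto simp: states_def)
  then have "1 = measure_pmf.prob ?D (accepting P \<union> rejecting P \<union> restarting P)"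
    by (subst eq_commute, subst measure_pmf.prob_eq_1) (auto simp: AE_measure_pmf_iff)
  also have "\<dots> = measure_pmf.prob ?D (accepting P) + measure_pmf.prob ?D (rejecting P)
      + measure_pmf.prob ?D (restarting P)"
    using disjoint by (simp add: measure_pmf.finite_measure_Union Int_Un_distrib2)
  finally show ?thesis
    by (simp add: acc_round_def rej_round_def ends_in_def round_result_eq)
qed

text \<open>
  With \<open>\<kappa>\<close> denoting the bound, the probability that the current round ends in \<open>S\<close> plus \<open>\<kappa>\<close> times
  the probability that it restarts is a harmonic function of the configuration, so its
  expectation along the run is constant.
\<close>

lemma prob_run_le:
  assumes pos: "acc_round + rej_round > 0"
    and S: "S = accepting P \<or> S = rejecting P"
  shows "measure_pmf.prob (run P w n) {c. fst c \<in> S}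
    \<le> ends_in S start / (acc_round + rej_round)"
proof -
  define \<kappa> where "\<kappa> = ends_in S start / (acc_round + rej_round)"
  define g where "g c = ends_in S c + ends_in (restarting P) c * \<kappa>" for c
  have \<kappa>0: "\<kappa> \<ge> 0" using pos by (simp add: \<kappa>_def ends_in_def)
  have g0: "g c \<ge> 0" for c using \<kappa>0 by (simp add: g_def ends_in_def)
  \<comment> \<open>With s = \<open>acc_round + rej_round\<close>, a round restarts with probability
    1 - s, and \<kappa> is the solution of \<kappa> = \<open>ends_in S start\<close> + (1 - s)
    \<kappa>.\<close>
  have gstart: "g start = \<kappa>"
    using pos by (simp add: g_def ends_in_restarting \<kappa>_def field_simps)
  have harm: "measure_pmf.expectation (step P w c) g = g c" if c: "c \<in> live P w" for c
  proof -
    obtain q i where qi: "c = (q, i)" by fastforce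
    show ?thesis
    proof (cases "q \<in> nonhalting P")
      case False
      then show ?thesis by (simp add: qi step_def)
    next
      case True
      note fin = integrable_measure_pmf_finite[OF finite_trans]
      have q: "q \<in> states P" using c by (simp add: live_def qi)
      \<comment> \<open>A restart resets \<open>g\<close> to \<kappa>, which is precisely the value
        that the right-hand side assigns to a restarting state.\<close>
      have "g (if q' \<in> restarting P then start else (q', Suc i))
          = ends_in S (q', Suc i) + ends_in (restarting P) (q', Suc i) * \<kappa>" for q'
      proof (cases "q' \<in> restarting P")
        case True
        with disj(4)[OF True] S have "q' \<notin> nonhalting P" "q' \<notin> S" by blast+
        with True show ?thesis by (simp add: gstart ends_in_halted)
      qed (simp add: g_def)
      then show ?thesis
        using c True unfolding qi
        by (simp add: expectation_step g_def[of "(q, i)"] ends_in_step fin[OF q])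
    qed
  qed
  have Eg: "measure_pmf.expectation (run P w n) g = \<kappa>"
  proof (induction n)
    case 0
    show ?case by (simp add: gstart)
  next
    case (Suc n)
    have "measure_pmf.expectation (run P w n) (\<lambda>c. measure_pmf.expectation (step P w c) g)
        = measure_pmf.expectation (run P w n) g"
      by (intro integral_cong_AE) (auto intro!: AE_pmfI harm run_live)
    then show ?case using Suc unfolding expectation_run_Suc by simp
  qed
  have "measure_pmf.prob (run P w n) {c. fst c \<in> S}
      = measure_pmf.expectation (run P w n) (indicator {c. fst c \<in> S})"
    by simp
  \<comment> \<open>\<open>g\<close> equals 1 on \<open>S\<close> and is nonnegative
    elsewhere.\<close>
  also have "\<dots> \<le> measure_pmf.expectation (run P w n) g"
  proof (intro expectation_finite_mono finite_run)
    fix c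
    show "indicator {c. fst c \<in> S} c \<le> g c"
    proof (cases "fst c \<in> S")
      case True
      then have "fst c \<notin> nonhalting P" "fst c \<notin> restarting P" using S disj(2,3) by blast+
      then show ?thesis using True by (cases c) (simp add: g_def ends_in_halted)
    qed (simp add: g0)
  qed
  finally show ?thesis unfolding Eg \<kappa>_def .
qed

section \<open>Halting time and overall probabilities\<close>

definition halted_by :: "nat \<Rightarrow> real" where
  "halted_by n = accepted_by P w n + rejected_by P w n"

lemma halted_by_eq:
  "halted_by n = measure_pmf.prob (run P w n) {c. fst c \<in> accepting P \<union> rejecting P}"
  unfolding halted_by_def accepted_by_def rejected_by_def using disjoint(1)
  by (subst measure_pmf.finite_measure_Union[symmetric])
    (auto intro!: arg_cong[where f = "measure_pmf.prob _"])

text \<open>The run visits only live configurations, whose states are never restarting, so not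
  having halted means being nonhalting.\<close>

lemma one_minus_halted_by:
  "1 - halted_by n
    = measure_pmf.expectation (run P w n) (indicator {c. fst c \<in> nonhalting P})"
proof -
  have "1 - halted_by n
      = measure_pmf.prob (run P w n) (- {c. fst c \<in> accepting P \<union> rejecting P})"
    unfolding halted_by_eq by (subst measure_pmf.prob_compl[symmetric]) (auto simp: Compl_eq_Diff_UNIV)
  also have "\<dots> = measure_pmf.prob (run P w n) {c. fst c \<in> nonhalting P}"
  proof (rule measure_pmf.finite_measure_eq_AE)
    show "AE c in run P w n. c \<in> - {c. fst c \<in> accepting P \<union> rejecting P}
        \<longleftrightarrow> c \<in> {c. fst c \<in> nonhalting P}"
    proof (rule AE_pmfI)
      fix c assume "c \<in> set_pmf (run P w n)"
      then have "c \<in> live P w" by (rule run_live)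
      then show "c \<in> - {c. fst c \<in> accepting P \<union> rejecting P}
        \<longleftrightarrow> c \<in> {c. fst c \<in> nonhalting P}"
        using disj(1)[of "fst c"] by (auto simp: live_def states_def)
    qed
  qed auto
  finally show ?thesis by simp
qed

lemma halted_by_mono: "halted_by n \<le> halted_by (Suc n)"
proof -
  have "1 - halted_by (Suc n) \<le> 1 - halted_by n"
    unfolding one_minus_halted_by expectation_run_Suc
  proof (intro expectation_finite_mono finite_run)
    fix c
    show "measure_pmf.expectation (step P w c) (indicator {c. fst c \<in> nonhalting P})
        \<le> (indicator {c. fst c \<in> nonhalting P} c :: real)"
      by (cases "fst c \<in> nonhalting P") (auto simp: step_def split: prod.splits)
  qed
  then show ?thesis by simp
qed

text \<open>
  The potential is the remaining length of the current round plus the expected length of all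
  later rounds; each step decreases it by at least one in expectation.
\<close>

lemma sum_not_halted_le:
  assumes pos: "acc_round + rej_round > 0"
  shows "(\<Sum>n<m. 1 - halted_by n) \<le> length (tape w) / (acc_round + rej_round)"
proof -
  define N where "N = length (tape w)"
  define \<kappa> where "\<kappa> = N / (acc_round + rej_round)"
  define g :: "'q \<times> nat \<Rightarrow> real" where
    "g c = (if fst c \<in> nonhalting P then real (N - snd c) else 0)
      + ends_in (restarting P) c * \<kappa>" for c
  have \<kappa>0: "\<kappa> \<ge> 0" using pos by (simp add: \<kappa>_def)
  have g0: "g c \<ge> 0" for c using \<kappa>0 by (simp add: g_def ends_in_def)
  \<comment> \<open>A round costs at most \<open>N\<close> steps, and \<kappa> solves \<kappa> = N +
    (1 - s) \<kappa>, where s is the halting probability of a round.\<close>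
  have gstart: "g start = \<kappa>"
    using pos by (simp add: g_def initial_nonhalting ends_in_restarting \<kappa>_def field_simps)
  have dec: "measure_pmf.expectation (step P w c) g
      \<le> g c - indicator {c. fst c \<in> nonhalting P} c" if c: "c \<in> live P w" for c
  proof -
    obtain q i where qi: "c = (q, i)" by fastforce
    show ?thesis
    proof (cases "q \<in> nonhalting P")
      case False
      then show ?thesis by (simp add: qi step_def)
    next
      case True
      note fin = integrable_measure_pmf_finite[OF finite_trans]
      have q: "q \<in> states P" using c by (simp add: live_def qi)
      have i: "i < N" using live_lt_length c True unfolding qi N_def by blast
      \<comment> \<open>Equality holds while the round goes on; halting or restarting early forfeits
        the remaining \<open>N - Suc i\<close> steps.\<close>
      have le: "g (if q' \<in> restarting P then start else (q', Suc i))
          \<le> real (N - Suc i) + ends_in (restarting P) (q', Suc i) * \<kappa>" for q'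
      proof (cases "q' \<in> restarting P")
        case True
        with disj(4)[OF True] show ?thesis by (simp add: gstart ends_in_halted)
      next
        case False
        then show ?thesis by (simp add: g_def)
      qed
      have "measure_pmf.expectation (step P w c) g
        \<le> measure_pmf.expectation (trans P (tape w ! i) q)
            (\<lambda>q'. real (N - Suc i) + ends_in (restarting P) (q', Suc i) * \<kappa>)"
        using c True unfolding qi
        by (subst expectation_step) (auto intro!: expectation_finite_mono le finite_trans q)
      also have "\<dots> = real (N - Suc i) + ends_in (restarting P) (q, i) * \<kappa>"
        using c True unfolding qi by (simp add: ends_in_step fin[OF q])
      also have "\<dots> = g c - indicator {c. fst c \<in> nonhalting P} c"
        using True i by (simp add: qi g_def of_nat_diff)
      finally show ?thesis .
    qed
  qed
  \<comment> \<open>Telescoping: each step lowers the expected potential by at least the probability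
    of not having halted.\<close>
  have "(\<Sum>n<m. 1 - halted_by n) + measure_pmf.expectation (run P w m) g \<le> \<kappa>"
  proof (induction m)
    case 0
    show ?case by (simp add: gstart)
  next
    case (Suc m)
    have "measure_pmf.expectation (run P w (Suc m)) g
        \<le> measure_pmf.expectation (run P w m) (\<lambda>c. g c - indicator {c. fst c \<in> nonhalting P} c)"
      unfolding expectation_run_Suc by (intro expectation_finite_mono finite_run dec run_live)
    also have "\<dots> = measure_pmf.expectation (run P w m) g - (1 - halted_by m)"
      unfolding one_minus_halted_by
      by (intro Bochner_Integration.integral_diff integrable_measure_pmf_finite finite_run)
    finally show ?case using Suc by simp
  qed
  moreover have "measure_pmf.expectation (run P w m) g \<ge> 0" by (simp add: g0)
  ultimately show ?thesis unfolding \<kappa>_def N_def by linarith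
qed

lemma halted_by_le_1: "halted_by n \<le> 1"
  unfolding halted_by_eq by simp

text \<open>The probabilities of not having halted have bounded partial sums, so they tend to
  0.\<close>

lemma halted_by_tendsto:
  assumes "acc_round + rej_round > 0"
  shows "halted_by \<longlonglongrightarrow> 1"
proof -
  have "summable (\<lambda>n. 1 - halted_by n)"
    by (rule summableI_nonneg_bounded[OF _ sum_not_halted_le[OF assms]])
      (simp add: halted_by_le_1)
  from tendsto_diff[OF tendsto_const[of 1] summable_LIMSEQ_zero[OF this]]
  show ?thesis by simp
qed

text \<open>Both quotients are upper bounds by \<open>prob_run_le\<close> and add up to 1. Since
  halting has limit probability 1, neither bound can be strict.\<close>

lemma halting_probs:
  assumes pos: "acc_round + rej_round > 0"
  shows "accept_prob P w = acc_round / (acc_round + rej_round)"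
    and "reject_prob P w = rej_round / (acc_round + rej_round)"
proof -
  let ?a = "acc_round / (acc_round + rej_round)" and ?r = "rej_round / (acc_round + rej_round)"
  have acc: "accepted_by P w n \<le> ?a" and rej: "rejected_by P w n \<le> ?r" for n
    using prob_run_le[OF pos, of "accepting P" n] prob_run_le[OF pos, of "rejecting P" n]
    by (simp_all add: accepted_by_def rejected_by_def ends_in_start)
  have bdd: "bdd_above (range (accepted_by P w))" "bdd_above (range (rejected_by P w))"
    using acc rej by (auto intro!: bdd_aboveI)
  have sum1: "?a + ?r = 1" using pos by (simp add: add_divide_distrib[symmetric])
  have a: "accept_prob P w \<le> ?a" unfolding accept_prob_def by (rule cSUP_least) (auto intro: acc)
  have r: "reject_prob P w \<le> ?r" unfolding reject_prob_def by (rule cSUP_least) (auto intro: rej)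
  have "halted_by n \<le> accept_prob P w + reject_prob P w" for n
    unfolding halted_by_def accept_prob_def reject_prob_def
    by (intro add_mono cSUP_upper bdd) auto
  then have "1 \<le> accept_prob P w + reject_prob P w"
    by (intro LIMSEQ_le_const2[OF halted_by_tendsto[OF pos]]) auto
  with a r sum1 show "accept_prob P w = ?a" "reject_prob P w = ?r" by linarith+
qed

lemma expected_runtime_le:
  assumes pos: "acc_round + rej_round > 0"
  shows "expected_runtime P w \<le> ennreal (length (tape w) / (acc_round + rej_round))"
proof -
  \<comment> \<open>This removes the infinite summand of \<open>expected_runtime\<close>.\<close>
  have "accept_prob P w + reject_prob P w = 1"
    using pos by (simp add: halting_probs add_divide_distrib[symmetric])
  then have "expected_runtime P w = (\<Sum>n. of_nat n * ennreal (halts_at P w n))"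
    by (simp add: expected_runtime_def)
  also have "\<dots> \<le> ennreal (length (tape w) / (acc_round + rej_round))"
  proof (rule suminf_le_const)
    fix m
    have halts: "halts_at P w (Suc n) = halted_by (Suc n) - halted_by n" for n
      by (simp add: halts_at_def halted_by_def)
    have halts0: "halts_at P w n \<ge> 0" for n
      by (cases n) (use halts halted_by_mono in \<open>auto simp: halts_at_def accepted_by_def rejected_by_def\<close>)
    \<comment> \<open>Summation by parts: the mean of a halting time T is computed from the tails,
      here truncated to n < T \<le> m.\<close>
    have "(\<Sum>n<Suc m. real n * halts_at P w n) = (\<Sum>n<m. halted_by m - halted_by n)"
    proof (induction m)
      case (Suc m)
      then show ?case by (simp add: halts sum_subtractf algebra_simps)
    qed simp
    also have "\<dots> \<le> (\<Sum>n<m. 1 - halted_by n)"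
      by (intro sum_mono) (simp add: halted_by_le_1)
    also have "\<dots> \<le> length (tape w) / (acc_round + rej_round)"
      by (rule sum_not_halted_le[OF pos])
    finally have le: "(\<Sum>n<Suc m. real n * halts_at P w n) \<le> length (tape w) / (acc_round + rej_round)" .
    have "(\<Sum>n<m. of_nat n * ennreal (halts_at P w n)) = ennreal (\<Sum>n<m. real n * halts_at P w n)"
      by (subst sum_ennreal[symmetric])
        (auto simp: halts0 ennreal_mult ennreal_of_nat_eq_real_of_nat)
    also have "\<dots> \<le> ennreal (length (tape w) / (acc_round + rej_round))"
      using le halts0[of m]
      by (intro ennreal_leI) (auto intro: order_trans[rotated])
    finally show "(\<Sum>n<m. of_nat n * ennreal (halts_at P w n))
        \<le> ennreal (length (tape w) / (acc_round + rej_round))" .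
  qed simp
  finally show ?thesis .
qed

end

lemma (in restart_pfa) acc_rej_round:
  "acc_round + rej_round = measure_pmf.prob (round_result P w) (accepting P \<union> rejecting P)"
  unfolding acc_round_def rej_round_def using disjoint(1)
  by (simp add: measure_pmf.finite_measure_Union)

subsection \<open>The automaton\<close>

declare One_nat_def [simp del]

section \<open>States, transitions and well-formedness of the automaton\<close>

text \<open>The probability of surviving letter \<open>l\<close> on track \<open>j\<close>. The
  equation between truth values selects \<open>a\<close> on track 2 and \<open>b\<close> on track
  3.\<close>

definition weight :: "real \<Rightarrow> nat \<Rightarrow> letter \<Rightarrow> real" where
  "weight x j l = (if j = 1 then x else if (j = 2) = (l = La) then x\<^sup>2 else 1)"

definition coin :: "real \<Rightarrow> nat \<Rightarrow> nat pmf" where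
  "coin r q = map_pmf (\<lambda>b. if b then q else 9) (bernoulli_pmf r)"

text \<open>
  On the left end-marker the state 0 moves to one of the tracks 1, 2, 3. Track \<open>j\<close> is in state
  \<open>j\<close> before the first \<open>b\<close> and in state \<open>j + 3\<close> afterwards; it survives \<open>a\<^sup>m b\<^sup>n\<close> with probability
  \<open>x\<^bsup>m+n\<^esup>\<close>, \<open>x\<^bsup>2m\<^esup>\<close> and \<open>x\<^bsup>2n\<^esup>\<close>, respectively. The states 7, 8, 9 accept, reject and restart.
\<close>

fun eq_trans :: "real \<Rightarrow> real \<Rightarrow> tape_symbol \<Rightarrow> nat \<Rightarrow> nat pmf" where
  "eq_trans p x LeftEnd q =
     bind_pmf (bernoulli_pmf p)
       (\<lambda>b. if b then return_pmf 1
            else map_pmf (\<lambda>b. if b then 2 else 3) (bernoulli_pmf (1 / 2)))"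
| "eq_trans p x (Letter La) q =
     (if q \<in> {1, 2, 3} then coin (weight x q La) q else return_pmf 8)"
| "eq_trans p x (Letter Lb) q =
     (if q \<in> {1, 2, 3} then coin (weight x q Lb) (q + 3)
      else if q \<in> {4, 5, 6} then coin (weight x (q - 3) Lb) q else return_pmf 8)"
| "eq_trans p x RightEnd q = return_pmf (if q \<in> {1, 4} then 7 else 8)"

definition eq_pfa :: "real \<Rightarrow> real \<Rightarrow> nat restart_pfa" where
  "eq_pfa p x = \<lparr>nonhalting = {0, 1, 2, 3, 4, 5, 6}, accepting = {7}, rejecting = {8},
     restarting = {9}, initial = 0, trans = eq_trans p x\<rparr>"

lemma eq_pfa_simps [simp]:
  "nonhalting (eq_pfa p x) = {0, 1, 2, 3, 4, 5, 6}" "accepting (eq_pfa p x) = {7}"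
  "rejecting (eq_pfa p x) = {8}" "restarting (eq_pfa p x) = {9}"
  "initial (eq_pfa p x) = 0" "trans (eq_pfa p x) = eq_trans p x"
  by (simp_all add: eq_pfa_def)

lemma states_eq_pfa: "states (eq_pfa p x) = {0, 1, 2, 3, 4, 5, 6, 7, 8, 9}"
  by (auto simp: states_def)

lemma set_coin: "set_pmf (coin r q) \<subseteq> {q, 9}"
  by (auto simp: coin_def)

text \<open>The left end-marker is omitted, so that each track can be followed on its own.\<close>

definition tail_prob :: "real \<Rightarrow> real \<Rightarrow> letter list \<Rightarrow> nat \<Rightarrow> nat set \<Rightarrow> real" where
  "tail_prob p x w q S =
     measure_pmf.prob (round_from (eq_pfa p x) (map Letter w @ [RightEnd]) q) S"

text \<open>The right end-marker sends each remaining nonhalting state to 7 or 8. This supplies the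
  last clause of \<open>is_restart_pfa\<close>.\<close>

lemma set_round_from_tail:
  "q \<in> {1, 2, 3, 4, 5, 6, 7, 8, 9} \<Longrightarrow>
   set_pmf (round_from (eq_pfa p x) (map Letter w @ [RightEnd]) q) \<subseteq> {7, 8, 9}"
proof (induction w arbitrary: q)
  case Nil
  then show ?case by auto
next
  case (Cons l w)
  show ?case
  proof (cases "q \<in> {7, 8, 9}")
    case True
    then show ?thesis by (auto simp: round_from_halted)
  next
    case False
    have sub: "set_pmf (eq_trans p x (Letter l) q) \<subseteq> {1, 2, 3, 4, 5, 6, 7, 8, 9}"
      using Cons.prems set_coin by (cases l) (fastforce dest: subsetD[OF set_coin])+
    have "set_pmf (round_from (eq_pfa p x) (map Letter (l # w) @ [RightEnd]) q)
        = (\<Union>q'\<in>set_pmf (eq_trans p x (Letter l) q).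
            set_pmf (round_from (eq_pfa p x) (map Letter w @ [RightEnd]) q'))"
      using False Cons.prems by auto
    then show ?thesis using sub Cons.IH by blast
  qed
qed

lemma is_restart_pfa_eq_pfa: "is_restart_pfa (eq_pfa p x)"
proof -
  have "set_pmf (eq_trans p x \<sigma> q) \<subseteq> states (eq_pfa p x)" if "q \<in> states (eq_pfa p x)" for \<sigma> q
  proof (cases \<sigma>)
    case (Letter l)
    then show ?thesis using that unfolding states_eq_pfa
      by (cases l) (fastforce dest: subsetD[OF set_coin])+
  qed (auto simp: states_eq_pfa split: if_splits)
  moreover have "set_pmf (round_result (eq_pfa p x) w) \<subseteq> {7, 8, 9}" for w
  proof -
    have "set_pmf (eq_trans p x LeftEnd 0) \<subseteq> {1, 2, 3, 4, 5, 6, 7, 8, 9}"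
      by (auto split: if_splits)
    then have "(\<Union>q\<in>set_pmf (eq_trans p x LeftEnd 0).
        set_pmf (round_from (eq_pfa p x) (map Letter w @ [RightEnd]) q)) \<subseteq> {7, 8, 9}"
      using set_round_from_tail by blast
    then show ?thesis
      by (simp add: round_result_eq tape_def del: eq_trans.simps)
  qed
  then have "AE q in round_result (eq_pfa p x) w. q \<notin> nonhalting (eq_pfa p x)" for w
    by (intro AE_pmfI) fastforce
  ultimately show ?thesis
    unfolding is_restart_pfa_def by (simp add: states_eq_pfa)
qed

lemma prob_bind_coin:
  assumes "0 \<le> r" "r \<le> 1"
  shows "measure_pmf.prob (bind_pmf (coin r q) f) S
    = r * measure_pmf.prob (f q) S + (1 - r) * measure_pmf.prob (f 9) S"
  using assms by (simp add: coin_def bind_map_pmf prob_bind_pmf)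

section \<open>Outcome probabilities of the tracks\<close>

context
  fixes p x :: real
  assumes p: "0 < p" "p < 1" and x: "0 < x" "x \<le> 1"
begin

lemma weight_bounds: "0 \<le> weight x j l" "weight x j l \<le> 1"
  using x by (auto simp: weight_def power_le_one)

text \<open>A lost coin leads to the restarting state 9, which lies outside \<open>S\<close> and
  contributes nothing.\<close>

lemma prob_coin_tail:
  assumes "9 \<notin> S"
  shows "measure_pmf.prob (bind_pmf (coin (weight x j l) q)
      (round_from (eq_pfa p x) (map Letter w @ [RightEnd]))) S
    = weight x j l * tail_prob p x w q S"
  using assms by (simp add: prob_bind_coin weight_bounds tail_prob_def round_from_halted)

lemma tail_prob_Nil:
  "q \<in> {1, 2, 3, 4, 5, 6} \<Longrightarrow> tail_prob p x [] q S = indicator S (if q \<in> {1, 4} then 7 else 8)"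
  by (auto simp: tail_prob_def bind_return_pmf)

lemma tail_prob_a:
  assumes "9 \<notin> S" "j \<in> {1, 2, 3}"
  shows "tail_prob p x (La # w) j S = weight x j La * tail_prob p x w j S"
  using assms prob_coin_tail[OF assms(1)] by (auto simp: tail_prob_def[of _ _ "_ # _"])

lemma tail_prob_b:
  assumes "9 \<notin> S" "j \<in> {1, 2, 3}"
  shows "tail_prob p x (Lb # w) j S = weight x j Lb * tail_prob p x w (j + 3) S"
  using assms prob_coin_tail[OF assms(1)] by (auto simp: tail_prob_def[of _ _ "_ # _"])

lemma tail_prob_bb:
  assumes "9 \<notin> S" "j \<in> {1, 2, 3}"
  shows "tail_prob p x (Lb # w) (j + 3) S = weight x j Lb * tail_prob p x w (j + 3) S"
  using assms prob_coin_tail[OF assms(1)] by (auto simp: tail_prob_def[of _ _ "_ # _"])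

lemma tail_prob_ba:
  assumes "j \<in> {1, 2, 3}"
  shows "tail_prob p x (La # w) (j + 3) S = indicator S 8"
  using assms by (auto simp: tail_prob_def bind_return_pmf round_from_halted)

lemma tail_prob_replicate_b:
  assumes "9 \<notin> S" "j \<in> {1, 2, 3}"
  shows "tail_prob p x (replicate n Lb) (j + 3) S
    = weight x j Lb ^ n * indicator S (if j = 1 then 7 else 8)"
proof (induction n)
  case 0
  show ?case using assms by (auto simp: tail_prob_Nil)
qed (simp add: tail_prob_bb[OF assms])

lemma tail_prob_replicate:
  assumes "9 \<notin> S" "j \<in> {1, 2, 3}"
  shows "tail_prob p x (replicate m La @ replicate n Lb) j S
    = weight x j La ^ m * weight x j Lb ^ n * indicator S (if j = 1 then 7 else 8)"
proof (induction m)
  case 0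
  show ?case
  proof (cases n)
    case 0
    then show ?thesis using assms by (auto simp: tail_prob_Nil)
  qed (simp add: tail_prob_b[OF assms] tail_prob_replicate_b[OF assms])
qed (simp add: tail_prob_a[OF assms])

lemma tail_prob_bad_b:
  assumes "j \<in> {1, 2, 3}" "\<nexists>n. w = replicate n Lb"
  shows "tail_prob p x w (j + 3) {7} = 0"
  using assms(2)
proof (induction w)
  case Nil
  then show ?case by (metis replicate_0)
next
  case (Cons l w)
  show ?case
  proof (cases l)
    case La
    then show ?thesis by (simp add: tail_prob_ba[OF assms(1)])
  next
    case Lb
    then have "\<nexists>n. w = replicate n Lb" using Cons.prems by (metis replicate_Suc)
    then show ?thesis using Cons.IH Lb by (simp add: tail_prob_bb[OF _ assms(1)])
  qed
qed

text \<open>In a word of another form some \<open>a\<close> follows a \<open>b\<close>, and there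
  every surviving track rejects.\<close>

lemma tail_prob_bad:
  assumes "j \<in> {1, 2, 3}" "\<nexists>m n. w = replicate m La @ replicate n Lb"
  shows "tail_prob p x w j {7} = 0"
  using assms(2)
proof (induction w)
  case Nil
  then show ?case by (metis replicate_0 append_Nil)
next
  case (Cons l w)
  show ?case
  proof (cases l)
    case La
    then have "\<nexists>m n. w = replicate m La @ replicate n Lb"
      using Cons.prems by (metis replicate_Suc append_Cons)
    then show ?thesis using Cons.IH La by (simp add: tail_prob_a[OF _ assms(1)])
  next
    case Lb
    then have "\<nexists>n. w = replicate n Lb"
      using Cons.prems by (metis replicate_Suc replicate_0 append_Nil)
    then show ?thesis using Lb by (simp add: tail_prob_b[OF _ assms(1)] tail_prob_bad_b[OF assms(1)])
  qed
qed

text \<open>Each \<open>b\<close> costs track 1 a factor \<open>x\<close>, while an \<open>a\<close>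
  at this stage rejects with certainty.\<close>

lemma tail_prob_halt_b: "x ^ length w \<le> tail_prob p x w 4 {7, 8}"
proof (induction w)
  case Nil
  show ?case by (simp add: tail_prob_Nil)
next
  case (Cons l w)
  show ?case
  proof (cases l)
    case La
    then show ?thesis using tail_prob_ba[of 1 w "{7, 8}"] x
      by (simp add: power_le_one mult_le_one)
  next
    case Lb
    then show ?thesis using tail_prob_bb[of "{7, 8}" 1 w] x Cons
      by (simp add: weight_def)
  qed
qed

lemma tail_prob_halt: "x ^ length w \<le> tail_prob p x w 1 {7, 8}"
proof (induction w)
  case Nil
  show ?case by (simp add: tail_prob_Nil)
next
  case (Cons l w)
  show ?case
    using tail_prob_a[of "{7, 8}" 1 w] tail_prob_b[of "{7, 8}" 1 w] tail_prob_halt_b[of w] x Cons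
    by (cases l) (simp_all add: weight_def)
qed

lemma round_prob:
  "measure_pmf.prob (round_result (eq_pfa p x) w) S
    = p * tail_prob p x w 1 S + (1 - p) / 2 * (tail_prob p x w 2 S + tail_prob p x w 3 S)"
proof -
  have "measure_pmf.prob (round_result (eq_pfa p x) w) S = p * tail_prob p x w 1 S
      + (1 - p) * (tail_prob p x w 2 S / 2 + tail_prob p x w 3 S / 2)"
    using p by (simp add: round_result_eq tape_def bind_assoc_pmf prob_bind_pmf
        bind_return_pmf bind_map_pmf tail_prob_def)
  also have "\<dots> = p * tail_prob p x w 1 S
      + (1 - p) / 2 * (tail_prob p x w 2 S + tail_prob p x w 3 S)"
    by (simp flip: add_divide_distrib)
  finally show ?thesis .
qed

section \<open>Error bounds and running time\<close>

interpretation restart_pfa "eq_pfa p x" w for w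
  by unfold_locales (rule is_restart_pfa_eq_pfa)

lemma halt_round_ge: "p * x ^ length w \<le> acc_round w + rej_round w"
proof -
  have "p * x ^ length w \<le> p * tail_prob p x w 1 {7, 8}"
    using p tail_prob_halt by simp
  also have "\<dots> \<le> measure_pmf.prob (round_result (eq_pfa p x) w) {7, 8}"
    using p unfolding round_prob by (simp add: tail_prob_def)
  finally show ?thesis by (simp add: acc_rej_round insert_commute[of 8 7])
qed

lemma halt_round_pos: "acc_round w + rej_round w > 0"
proof -
  have "0 < p * x ^ length w" using p x by simp
  then show ?thesis using halt_round_ge[of w] by linarith
qed

lemma acc_rej_round_replicate:
  "acc_round (replicate m La @ replicate n Lb) = p * x ^ (m + n)"
  "rej_round (replicate m La @ replicate n Lb) = (1 - p) / 2 * (x ^ (2 * m) + x ^ (2 * n))"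
proof -
  show "acc_round (replicate m La @ replicate n Lb) = p * x ^ (m + n)"
    by (simp add: acc_round_def round_prob tail_prob_replicate weight_def power_add)
  show "rej_round (replicate m La @ replicate n Lb) = (1 - p) / 2 * (x ^ (2 * m) + x ^ (2 * n))"
    by (simp add: rej_round_def round_prob tail_prob_replicate weight_def flip: power_mult)
qed

text \<open>For equal exponents all three tracks survive with probability
  \<open>x ^ (2 * n)\<close>, which cancels; only the choice of the track matters.\<close>

lemma accept_prob_eq: "accept_prob (eq_pfa p x) (replicate n La @ replicate n Lb) = p"
proof -
  let ?w = "replicate n La @ replicate n Lb"
  have acc: "acc_round ?w = p * x ^ (2 * n)" and rej: "rej_round ?w = (1 - p) * x ^ (2 * n)"
    unfolding acc_rej_round_replicate by (simp_all flip: mult_2)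
  have "acc_round ?w + rej_round ?w = x ^ (2 * n)"
    unfolding acc rej by (simp add: left_diff_distrib)
  then show ?thesis
    unfolding halting_probs[OF halt_round_pos] acc using x by simp
qed

lemma acc_round_le:
  assumes "w \<notin> L_eq" and c: "c \<ge> 0" "p \<le> c * ((1 - p) / 2) / x"
  shows "acc_round w \<le> c * rej_round w"
proof (cases "\<exists>m n. w = replicate m La @ replicate n Lb")
  case True
  then obtain m n where w: "w = replicate m La @ replicate n Lb" by blast
  with assms have "m \<noteq> n" by (auto simp: L_eq_def)
  \<comment> \<open>Unequal exponents give i + j \<ge> 2 i + 1, which yields the extra factor
    \<open>x\<close> that cancels the division by \<open>x\<close> in the bound on
    \<open>p\<close>.\<close>
  have le: "x ^ (i + j) \<le> x * x ^ (2 * i)" if "i < j" for i j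
  proof -
    have "x ^ (i + j) \<le> x ^ Suc (2 * i)" using that x by (intro power_decreasing) auto
    then show ?thesis by simp
  qed
  have "x ^ (m + n) \<le> x * (x ^ (2 * m) + x ^ (2 * n))"
  proof (cases "m < n")
    case True
    then show ?thesis using le[of m n] x by (simp add: distrib_left add_increasing2)
  next
    case False
    with \<open>m \<noteq> n\<close> show ?thesis using le[of n m] x
      by (simp add: distrib_left add_increasing add.commute)
  qed
  then have "p * x ^ (m + n) \<le> c * ((1 - p) / 2) / x * (x * (x ^ (2 * m) + x ^ (2 * n)))"
    using p c x by (intro mult_mono) auto
  also have "\<dots> = c * ((1 - p) / 2 * (x ^ (2 * m) + x ^ (2 * n)))"
    using x by simp
  finally show ?thesis by (simp add: w acc_rej_round_replicate)
next
  case False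
  then have "acc_round w = 0" by (simp add: acc_round_def round_prob tail_prob_bad)
  then show ?thesis using c(1) by (simp add: rej_round_def)
qed

text \<open>A round that accepts at most \<open>c\<close> times as often as it rejects leaves at
  most the fraction \<open>c\<close> of all halting to acceptance.\<close>

lemma reject_prob_ge:
  assumes "w \<notin> L_eq" "c \<ge> 0" "p \<le> c * ((1 - p) / 2) / x"
  shows "reject_prob (eq_pfa p x) w \<ge> 1 - c"
proof -
  have "acc_round w \<le> c * rej_round w" by (rule acc_round_le[OF assms])
  also have "\<dots> \<le> c * (acc_round w + rej_round w)"
    using assms(2) by (intro mult_left_mono) (auto simp: acc_round_def)
  finally have "acc_round w \<le> c * (acc_round w + rej_round w)" .
  then have "(1 - c) * (acc_round w + rej_round w) \<le> rej_round w" by (simp add: algebra_simps)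
  then show ?thesis
    using halt_round_pos[of w] by (simp add: halting_probs[OF halt_round_pos] pos_le_divide_eq)
qed

lemma expected_runtime_eq_pfa_le:
  "expected_runtime (eq_pfa p x) w \<le> ennreal ((real (length w) + 2) / (p * x ^ length w))"
proof -
  have "real (length (tape w)) / (acc_round w + rej_round w)
      \<le> (real (length w) + 2) / (p * x ^ length w)"
    using halt_round_ge[of w] p x by (intro frac_le) (auto simp: tape_def)
  then show ?thesis
    using expected_runtime_le[OF halt_round_pos, of w] by (meson ennreal_leI order_trans)
qed

lemma has_expected_runtime_O_eq_pfa:
  "has_expected_runtime_O (eq_pfa p x) (\<lambda>w. (1 / x) ^ length w * real (length w))"
  unfolding has_expected_runtime_O_def
proof (intro conjI allI)
  fix w
  show "expected_runtime (eq_pfa p x) w < \<infinity>"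
    using expected_runtime_eq_pfa_le[of w] by (simp add: order_le_less_trans)
next
  show "(\<lambda>w. enn2real (expected_runtime (eq_pfa p x) w))
      \<in> O[filtercomap length at_top](\<lambda>w. (1 / x) ^ length w * real (length w))"
  \<comment> \<open>The two end-markers give |w| + 2 tape cells, at most 3 |w| for nonempty
    \<open>w\<close>.\<close>
  proof (rule bigoI[where c = "3 / p"])
    have "norm (enn2real (expected_runtime (eq_pfa p x) w))
        \<le> 3 / p * norm ((1 / x) ^ length w * real (length w))" if "length w \<ge> 1" for w :: "letter list"
    proof -
      have "enn2real (expected_runtime (eq_pfa p x) w) \<le> (real (length w) + 2) / (p * x ^ length w)"
        using enn2real_mono[OF expected_runtime_eq_pfa_le[of w]] p x by simp
      also have "\<dots> \<le> (3 * real (length w)) / (p * x ^ length w)"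
        using that p x by (intro divide_right_mono) auto
      also have "\<dots> = 3 / p * norm ((1 / x) ^ length w * real (length w))"
        using x by (simp add: power_divide)
      finally show ?thesis by simp
    qed
    then show "\<forall>\<^sub>F w in filtercomap length at_top. norm (enn2real (expected_runtime (eq_pfa p x) w))
        \<le> 3 / p * norm ((1 / x) ^ length w * real (length w))"
      by (intro eventually_mono[OF eventually_filtercomapI[OF eventually_ge_at_top[of "1::nat"]]])
  qed
qed

end

theorem theorem23:
  "\<exists>k::nat. \<forall>\<epsilon>::real. 0 < \<epsilon> \<and> \<epsilon> \<le> 1 \<longrightarrow>
     (\<exists>P :: nat restart_pfa.
        is_restart_pfa P \<and> card (states P) = k \<and>
        recognizes_with_error P L_eq \<epsilon> \<and>
        has_expected_runtime_O P
          (\<lambda>w. (2 / \<epsilon>\<^sup>2) ^ length w * real (length w)))"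
\<comment> \<open>Only the transition probabilities depend on \<epsilon>; the states are always 0 to
  9.\<close>
proof (intro exI[of _ 10] allI impI)
  fix \<epsilon> :: real
  assume \<epsilon>: "0 < \<epsilon> \<and> \<epsilon> \<le> 1"
  \<comment> \<open>This makes p : (1 - p) equal to 1 : \<epsilon>, and \<open>p\<close> is the
    acceptance probability of members.\<close>
  define p where "p = 1 / (1 + \<epsilon>)"
  \<comment> \<open>With 1 - p = \<epsilon> p, this value turns the hypothesis of
    \<open>reject_prob_ge\<close> for c = \<epsilon> into an equality; 1 / x is the base of the
    runtime bound.\<close>
  define x where "x = \<epsilon>\<^sup>2 / 2"
  have px: "0 < p" "p < 1" "0 < x" "x \<le> 1"
    using \<epsilon> power_le_one[of \<epsilon> 2] by (auto simp: p_def x_def)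
  have "1 - p = \<epsilon> * p"
    using \<epsilon> by (simp add: p_def field_simps)
  then have "p = \<epsilon> * ((1 - p) / 2) / x"
    using \<epsilon> by (simp add: x_def power2_eq_square)
  then have rej: "reject_prob (eq_pfa p x) w \<ge> 1 - \<epsilon>" if "w \<notin> L_eq" for w
    using reject_prob_ge[OF px that, of \<epsilon>] \<epsilon> by simp
  have "1 - \<epsilon> \<le> p"
    using \<epsilon> by (simp add: p_def field_simps)
  then have "accept_prob (eq_pfa p x) w \<ge> 1 - \<epsilon>" if "w \<in> L_eq" for w
    using that accept_prob_eq[OF px] by (auto simp: L_eq_def)
  with rej have "recognizes_with_error (eq_pfa p x) L_eq \<epsilon>"
    by (simp add: recognizes_with_error_def)
  moreover have "has_expected_runtime_O (eq_pfa p x)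
      (\<lambda>w. (2 / \<epsilon>\<^sup>2) ^ length w * real (length w))"
    using has_expected_runtime_O_eq_pfa[OF px] unfolding x_def by simp
  ultimately show "\<exists>P :: nat restart_pfa. is_restart_pfa P \<and> card (states P) = 10 \<and>
        recognizes_with_error P L_eq \<epsilon> \<and>
        has_expected_runtime_O P (\<lambda>w. (2 / \<epsilon>\<^sup>2) ^ length w * real (length w))"
    by (intro exI[of _ "eq_pfa p x"]) (simp add: states_eq_pfa is_restart_pfa_eq_pfa)
qed

end
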